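(* Let $\mathbf{WQSym}$ denote the $\mathbb{K}$-span of the $\mathbf{M}_u$, $u$ running over packed words of length $\ge1$, equipped with the product $\#$ (an associative algebra with unit $\mathbf{M}_1$). Then $(\mathbf{WQSym},\#)$ is a free associative unital algebra, freely generated by $\{\mathbf{S}^u: u\text{ non-secable}\}$, and also freely generated by $\{\mathbf{M}_u: u\text{ non-secable}\}$.
   Context: Let $A=\{a_1<a_2<\cdots\}$ be an infinite totally ordered alphabet (identified with $\{1<2<\cdots\}$) and $\mathbb{K}$ a field; work with formal $\mathbb{K}$-linear combinations of nonempty words over $A$. The $\#$ product of words is $(ux)\#(yv)=uxv$ if the letters $x,y$ are equal and $0$ otherwise ($u,v$ words, $x,y$ letters), extended bilinearly. For a word $w$ with distinct letters $b_1<\dots<b_r$, $\mathrm{pack}(w)$ is the image of $w$ under $b_i\mapsto i$; $w$ is packed if $\mathrm{pack}(w)=w$; $\mathbf{M}_u=\sum_{\mathrm{pack}(w)=u}w$. For a packed word $w$ and $i<j$, the pair $(i,j)$ has coefficient $1$ if $w_i>w_j$, $1/2$ if $w_i=w_j$, $0$ otherwise; $u\le v$ (pseudo-permutohedron order, same length) iff every pair's coefficient in $u$ is at most its coefficient in $v$; $\mathbf{S}^u=\sum_{v\le u}\mathbf{M}_v$. A packed word $u$ of length $n$ is secable if there exists $k$ with $2\le k<n$ such that (i) the set $\{u_1,\dots,u_k\}$ is the union of an interval of integers with maximal element $u_k$ and another interval of integers which is either empty or has maximal element $\max(u)$, and (ii) $\{u_1,\dots,u_k\}\cap\{u_k,\dots,u_n\}=\{u_k\}$.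 A packed word is non-secable if it has length at least $2$ and is not secable. *)

theory Defs
  imports Complex_Main "HOL-Library.Function_Algebras" "HOL-Library.Poly_Mapping"
begin

section \<open>Unital associative algebras and free generation\<close>

locale unital_algebra = vector_space scale
  for scale :: "'k::field \<Rightarrow> 'v::ab_group_add \<Rightarrow> 'v" +
  fixes mult :: "'v \<Rightarrow> 'v \<Rightarrow> 'v" and e :: 'v and A :: "'v set"
  assumes subspace_carrier: "subspace A"
    and one_closed: "e \<in> A"
    and mult_closed: "x \<in> A \<Longrightarrow> y \<in> A \<Longrightarrow> mult x y \<in> A"
    and mult_assoc: "x \<in> A \<Longrightarrow> y \<in> A \<Longrightarrow> z \<in> A \<Longrightarrow> mult (mult x y) z = mult x (mult y z)"
    and mult_one_left: "x \<in> A \<Longrightarrow> mult e x = x"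
    and mult_one_right: "x \<in> A \<Longrightarrow> mult x e = x"
    and mult_add_left: "x \<in> A \<Longrightarrow> y \<in> A \<Longrightarrow> z \<in> A \<Longrightarrow> mult (x + y) z = mult x z + mult y z"
    and mult_add_right: "x \<in> A \<Longrightarrow> y \<in> A \<Longrightarrow> z \<in> A \<Longrightarrow> mult x (y + z) = mult x y + mult x z"
    and mult_scale_left: "x \<in> A \<Longrightarrow> y \<in> A \<Longrightarrow> mult (scale c x) y = scale c (mult x y)"
    and mult_scale_right: "x \<in> A \<Longrightarrow> y \<in> A \<Longrightarrow> mult x (scale c y) = scale c (mult x y)"

text \<open>The free algebra \<open>K\<langle>G\<rangle>\<close> has the words over \<open>G\<close> (the empty word being its unit, concatenation
  its product) as a linear basis: its elements are the finitely supported functions on words over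
  \<open>G\<close>, that is, noncommutative polynomials in \<open>G\<close>.\<close>

definition free_algebra :: "'v set \<Rightarrow> ('v list \<Rightarrow>\<^sub>0 'k::field) set" where
  "free_algebra G = {p. Poly_Mapping.keys p \<subseteq> lists G}"

text \<open>The linear extension of \<open>[g\<^sub>1, \<dots>, g\<^sub>m] \<mapsto> g\<^sub>1 \<cdots> g\<^sub>m\<close>; when \<open>G\<close> lies in the algebra, this is the
  unique morphism of unital algebras out of \<open>K\<langle>G\<rangle>\<close> that is the identity on \<open>G\<close>.\<close>

definition evaluation ::
  "('k::field \<Rightarrow> 'v::ab_group_add \<Rightarrow> 'v) \<Rightarrow> ('v \<Rightarrow> 'v \<Rightarrow> 'v) \<Rightarrow> 'v \<Rightarrow> ('v list \<Rightarrow>\<^sub>0 'k) \<Rightarrow> 'v" where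
  "evaluation scale mult e p =
     (\<Sum>w\<in>Poly_Mapping.keys p. scale (Poly_Mapping.lookup p w) (foldr mult w e))"

locale freely_generated_algebra = unital_algebra +
  fixes G :: "'b set"
  assumes generators_closed: "G \<subseteq> A"
    and evaluation_bij: "bij_betw (evaluation scale mult e) (free_algebra G) A"


section \<open>Formal linear combinations of words and the \<open>#\<close> product\<close>

text \<open>A possibly infinite formal linear combination of words is its coefficient function. Letters
  are positive integers.\<close>

type_synonym word = "nat list"
type_synonym 'k series = "word \<Rightarrow> 'k"

definition is_word :: "word \<Rightarrow> bool" where
  "is_word w \<longleftrightarrow> w \<noteq> [] \<and> (\<forall>x\<in>set w. 1 \<le> x)"

definition series_scale :: "'k::field \<Rightarrow> 'k series \<Rightarrow> 'k series" where
  "series_scale c f = (\<lambda>w. c * f w)"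

interpretation series: vector_space "series_scale :: 'k::field \<Rightarrow> 'k series \<Rightarrow> 'k series"
  by unfold_locales (auto simp: series_scale_def fun_eq_iff algebra_simps)

text \<open>On words, \<open>ux # yv = uxv\<close> if \<open>x = y\<close>; the value \<open>None\<close> stands for the product \<open>0\<close>.\<close>

definition word_sharp :: "word \<Rightarrow> word \<Rightarrow> word option" where
  "word_sharp p q =
     (if p \<noteq> [] \<and> q \<noteq> [] \<and> last p = hd q then Some (p @ tl q) else None)"

definition sharp :: "'k::field series \<Rightarrow> 'k series \<Rightarrow> 'k series" where
  "sharp f g = (\<lambda>w. \<Sum>(p, q) | word_sharp p q = Some w. f p * g q)"

text \<open>Each word arises from only finitely many pairs, so the sum in \<open>sharp\<close> is a genuine one.\<close>

lemma finite_word_sharp: "finite {(p, q). word_sharp p q = Some w}"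
proof (rule finite_subset)
  show "{(p, q). word_sharp p q = Some w} \<subseteq> (\<lambda>i. (take (Suc i) w, drop i w)) ` {..<length w}"
  proof clarify
    fix p q
    assume "word_sharp p q = Some w"
    then have "p \<noteq> []" "q \<noteq> []" "last p = hd q" "w = p @ tl q"
      by (auto simp: word_sharp_def split: if_splits)
    then obtain u x v where "p = u @ [x]" "q = x # v" "w = u @ x # v"
      by (cases p rule: rev_cases; cases q) auto
    then show "(p, q) \<in> (\<lambda>i. (take (Suc i) w, drop i w)) ` {..<length w}"
      by (intro image_eqI[of _ _ "length u"]) auto
  qed
qed simp


section \<open>Packed words and the algebra \<open>WQSym\<close>\<close>

definition pack :: "word \<Rightarrow> word" where
  "pack w = map (\<lambda>x. card {y \<in> set w. y \<le> x}) w"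

definition packed :: "word \<Rightarrow> bool" where
  "packed w \<longleftrightarrow> pack w = w"

definition M :: "word \<Rightarrow> 'k::field series" where
  "M u = (\<lambda>w. if is_word w \<and> pack w = u then 1 else 0)"

definition WQSym :: "'k::field series set" where
  "WQSym = series.span {M u | u. packed u \<and> 1 \<le> length u}"

definition inversion_coeff :: "word \<Rightarrow> nat \<Rightarrow> nat \<Rightarrow> rat" where
  "inversion_coeff w i j =
     (if w ! i > w ! j then 1 else if w ! i = w ! j then 1 / 2 else 0)"

definition pseudo_perm_le :: "word \<Rightarrow> word \<Rightarrow> bool" where
  "pseudo_perm_le u v \<longleftrightarrow> length u = length v \<and>
     (\<forall>i j. i < j \<longrightarrow> j < length u \<longrightarrow> inversion_coeff u i j \<le> inversion_coeff v i j)"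

definition S :: "word \<Rightarrow> 'k::field series" where
  "S u = (\<Sum>v | packed v \<and> pseudo_perm_le v u. M v)"

lemma finite_packed_le: "finite {v. packed v \<and> pseudo_perm_le v u}"
proof (rule finite_subset)
  show "{v. packed v \<and> pseudo_perm_le v u} \<subseteq>
      {v. set v \<subseteq> {..length u} \<and> length v = length u}"
  proof clarify
    fix v
    assume v: "packed v" "pseudo_perm_le v u"
    have "x \<le> length v" if "x \<in> set v" for x
    proof -
      from that v(1) have "x \<in> set (pack v)" by (simp add: packed_def)
      then obtain z where "x = card {y \<in> set v. y \<le> z}" by (auto simp: pack_def)
      also have "\<dots> \<le> card (set v)" by (rule card_mono) auto
      also have "\<dots> \<le> length v" by (rule card_length)
      finally show ?thesis .
    qed
    then show "set v \<subseteq> {..length u} \<and> length v = length u"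
      using v(2) by (auto simp: pseudo_perm_le_def)
  qed
qed (simp add: finite_lists_length_eq)

text \<open>Indices are shifted by one: \<open>u\<^sub>k\<close> is \<open>u ! (k - 1)\<close>, and \<open>{u\<^sub>k, \<dots>, u\<^sub>n}\<close> is
  \<open>set (drop (k - 1) u)\<close>. The second interval is empty when \<open>b > Max (set u)\<close>.\<close>

definition secable :: "word \<Rightarrow> bool" where
  "secable u \<longleftrightarrow> packed u \<and>
     (\<exists>k. 2 \<le> k \<and> k < length u \<and>
        (\<exists>a b. a \<le> u ! (k - 1) \<and>
           set (take k u) = {a..u ! (k - 1)} \<union> {b..Max (set u)}) \<and>
        set (take k u) \<inter> set (drop (k - 1) u) = {u ! (k - 1)})"

definition nonsecable :: "word \<Rightarrow> bool" where
  "nonsecable u \<longleftrightarrow> packed u \<and> 2 \<le> length u \<and> \<not> secable u"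

end

theory Submission
  imports Defs
begin

text \<open>
  If packed words \<open>p\<close> and \<open>q\<close> are overlapped in one letter, the packed words obtained (the terms of
  \<open>M p # M q\<close>) have a largest element in the pseudo-permutohedron order. Being secable at \<open>k\<close> means
  precisely that \<open>u\<close> is the largest word with its two pieces, so packed words form a free monoid on
  the non-secable ones under taking this largest element. Any family \<open>T u\<close> that has coefficient 1
  at \<open>u\<close> and is supported on words below \<open>u\<close>, such as \<open>M\<close> and \<open>S\<close>, therefore has products over lists
  of non-secable words that are unitriangular with respect to the basis \<open>M\<close>, hence form a basis.
\<close>

section \<open>The pseudo-permutohedron order and packing\<close>

text \<open>The coefficients only take the values 0 < 1/2 < 1, so comparing them amounts to two
  implications: a coefficient of at most 1/2 in \<open>u\<close> stays at most 1/2 in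
  \<open>w\<close>, and a coefficient 0 stays 0. On arbitrary words the relation is only a
  preorder.\<close>

lemma pseudo_perm_le_iff:
  "pseudo_perm_le w u \<longleftrightarrow> length w = length u \<and>
     (\<forall>i j. i < j \<longrightarrow> j < length u \<longrightarrow>
        (u ! i \<le> u ! j \<longrightarrow> w ! i \<le> w ! j) \<and> (u ! i < u ! j \<longrightarrow> w ! i < w ! j))"
proof -
  have "inversion_coeff w i j \<le> inversion_coeff u i j \<longleftrightarrow>
      (u ! i \<le> u ! j \<longrightarrow> w ! i \<le> w ! j) \<and> (u ! i < u ! j \<longrightarrow> w ! i < w ! j)" for i j
    by (auto simp: inversion_coeff_def)
  then show ?thesis
    unfolding pseudo_perm_le_def by auto
qed

lemma pseudo_perm_leD:
  assumes "pseudo_perm_le w u"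
  shows "length w = length u"
    and "i < j \<Longrightarrow> j < length u \<Longrightarrow> u ! i \<le> u ! j \<Longrightarrow> w ! i \<le> w ! j"
    and "i < j \<Longrightarrow> j < length u \<Longrightarrow> u ! i < u ! j \<Longrightarrow> w ! i < w ! j"
  using assms by (auto simp: pseudo_perm_le_iff)

lemma pseudo_perm_le_refl: "pseudo_perm_le w w"
  by (simp add: pseudo_perm_le_iff)

lemma pseudo_perm_le_trans: "pseudo_perm_le u v \<Longrightarrow> pseudo_perm_le v w \<Longrightarrow> pseudo_perm_le u w"
  by (auto simp: pseudo_perm_le_iff)

lemma pseudo_perm_le_map:
  assumes "strict_mono_on (set w) f"
  shows "pseudo_perm_le (map f w) w" "pseudo_perm_le w (map f w)"
  using assms
  by (auto simp: pseudo_perm_le_iff strict_mono_on_less strict_mono_on_less_eq)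

lemma pack_map:
  assumes f: "strict_mono_on (set w) f"
  shows "pack (map f w) = pack w"
proof -
  have "card {y \<in> f ` set w. y \<le> f x} = card {y \<in> set w. y \<le> x}" if "x \<in> set w" for x
  proof -
    have "{y \<in> f ` set w. y \<le> f x} = f ` {y \<in> set w. y \<le> x}"
      using that f by (auto simp: strict_mono_on_less_eq)
    moreover have "inj_on f {y \<in> set w. y \<le> x}"
      using strict_mono_on_imp_inj_on[OF f] by (rule inj_on_subset) auto
    ultimately show ?thesis
      by (simp add: card_image)
  qed
  then show ?thesis
    by (simp add: pack_def)
qed

text \<open>This presents \<open>pack w\<close> as a strictly increasing relabelling of
  \<open>w\<close>. Hence \<open>pack\<close> is idempotent, and a word and its packing lie below
  each other.\<close>

lemma strict_mono_on_rank:
  fixes w :: word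
  shows "strict_mono_on (set w) (\<lambda>x. card {y \<in> set w. y \<le> x})"
proof (rule strict_mono_onI)
  fix x y assume "x \<in> set w" "y \<in> set w" "x < y"
  then have "{z \<in> set w. z \<le> x} \<subseteq> {z \<in> set w. z \<le> y}"
      "y \<in> {z \<in> set w. z \<le> y} - {z \<in> set w. z \<le> x}"
    by auto
  then have "{z \<in> set w. z \<le> x} \<subset> {z \<in> set w. z \<le> y}"
    by blast
  then show "card {z \<in> set w. z \<le> x} < card {z \<in> set w. z \<le> y}"
    by (intro psubset_card_mono) auto
qed

lemma length_pack [simp]: "length (pack w) = length w"
  by (simp add: pack_def)

lemma pack_Nil_iff [simp]: "pack w = [] \<longleftrightarrow> w = []"
  by (simp add: pack_def)

lemma packed_pack [simp]: "packed (pack w)"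
  using pack_map[OF strict_mono_on_rank[of w]] by (simp add: packed_def flip: pack_def)

lemma pack_le: "pseudo_perm_le (pack w) w" "pseudo_perm_le w (pack w)"
  using pseudo_perm_le_map[OF strict_mono_on_rank[of w]] by (simp_all flip: pack_def)

lemma set_pack: "set (pack w) = {1..card (set w)}"
proof (rule card_subset_eq)
  show "set (pack w) \<subseteq> {1..card (set w)}"
    by (auto simp: pack_def Suc_le_eq card_gt_0_iff intro!: card_mono)
  have "inj_on (\<lambda>x. card {y \<in> set w. y \<le> x}) (set w)"
    using strict_mono_on_rank by (rule strict_mono_on_imp_inj_on)
  then show "card (set (pack w)) = card {1..card (set w)}"
    by (simp add: pack_def card_image)
qed simp

lemma set_packed: "packed u \<Longrightarrow> set u = {1..card (set u)}"
  using set_pack[of u] by (simp add: packed_def)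

lemma is_word_packed: "packed u \<Longrightarrow> is_word u \<longleftrightarrow> u \<noteq> []"
  using set_packed[of u] unfolding is_word_def by auto

text \<open>Mutual comparability means that all pairs of positions compare alike in both words, so
  one word is a strictly increasing relabelling of the other.\<close>

lemma pack_eqI:
  assumes "pseudo_perm_le v w" "pseudo_perm_le w v"
  shows "pack v = pack w"
proof -
  have len: "length v = length w"
    using assms(1) by (rule pseudo_perm_leD)
  have less: "v ! i < v ! j \<longleftrightarrow> w ! i < w ! j" if "i < length w" "j < length w" for i j
    using assms that unfolding pseudo_perm_le_iff
    by (metis leD leI nat_neq_iff)
  \<comment> \<open>The relabelling reads off \<open>w\<close> at any position where
    \<open>v\<close> has the letter \<open>x\<close>; the choice is harmless because positions with
    equal letters in \<open>v\<close> have equal letters in \<open>w\<close>.\<close>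
  define f where "f x = w ! (SOME i. i < length w \<and> v ! i = x)" for x
  have f: "f (v ! i) = w ! i" if "i < length w" for i
  proof -
    define k where "k = (SOME k. k < length w \<and> v ! k = v ! i)"
    have "k < length w \<and> v ! k = v ! i"
      unfolding k_def by (rule someI[of _ i]) (simp add: that)
    then have "w ! k = w ! i"
      using less[of k i] less[of i k] that by auto
    then show ?thesis
      by (simp add: f_def k_def)
  qed
  have "w = map f v"
    using len f by (auto intro!: nth_equalityI)
  moreover have "strict_mono_on (set v) f"
    using len less f by (auto simp: in_set_conv_nth intro!: strict_mono_onI)
  ultimately show ?thesis
    by (simp add: pack_map)
qed

lemma pseudo_perm_le_antisym:
  assumes "packed u" "packed v" "pseudo_perm_le u v" "pseudo_perm_le v u"
  shows "u = v"
  using pack_eqI[OF assms(3,4)] assms(1,2) by (simp add: packed_def)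

lemma pseudo_perm_le_take: "pseudo_perm_le w u \<Longrightarrow> pseudo_perm_le (take k w) (take k u)"
  by (auto simp: pseudo_perm_le_iff)

lemma pseudo_perm_le_drop: "pseudo_perm_le w u \<Longrightarrow> pseudo_perm_le (drop k w) (drop k u)"
  by (auto simp: pseudo_perm_le_iff)

lemma pack_take_pack: "pack (take k (pack w)) = pack (take k w)"
  by (intro pack_eqI pseudo_perm_le_take pack_le)

lemma pack_drop_pack: "pack (drop k (pack w)) = pack (drop k w)"
  by (intro pack_eqI pseudo_perm_le_drop pack_le)

lemma is_word_take: "is_word w \<Longrightarrow> is_word (take (Suc i) w)"
  by (auto simp: is_word_def dest: in_set_takeD)

lemma is_word_drop: "is_word w \<Longrightarrow> i < length w \<Longrightarrow> is_word (drop i w)"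
  by (auto simp: is_word_def dest: in_set_dropD)


section \<open>Cuts and gluing\<close>

text \<open>Across \<open>c\<close>, an inequality \<open>u ! i \<le> u ! j\<close> occurs only when
  transitivity through \<open>u ! c\<close> forces it; every other straddling pair is an inversion,
  of maximal coefficient. The letter at \<open>c\<close> (counted from 0) is shared by the pieces
  \<open>take (Suc c) u\<close> and \<open>drop c u\<close>. The first and last positions are
  vacuously cuts.\<close>

definition cut_at :: "word \<Rightarrow> nat \<Rightarrow> bool" where
  "cut_at u c \<longleftrightarrow> (\<forall>i j. i < c \<longrightarrow> c < j \<longrightarrow> j < length u \<longrightarrow> u ! i \<le> u ! j \<longrightarrow>
      u ! i \<le> u ! c \<and> u ! c \<le> u ! j)"

lemma cutD:
  assumes "cut_at u c" "i < c" "c < j" "j < length u" "u ! i \<le> u ! j"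
  shows "u ! i \<le> u ! c" "u ! c \<le> u ! j"
  using assms by (auto simp: cut_at_def)

lemma cut_cong:
  assumes "pseudo_perm_le v w" "pseudo_perm_le w v" "cut_at v c"
  shows "cut_at w c"
  unfolding cut_at_def
proof (intro allI impI)
  fix i j assume ij: "i < c" "c < j" "j < length w" "w ! i \<le> w ! j"
  have len: "length v = length w"
    using assms(1) by (rule pseudo_perm_leD)
  have "v ! i \<le> v ! j"
    using ij pseudo_perm_leD(2)[OF assms(1), of i j] by auto
  then have "v ! i \<le> v ! c" "v ! c \<le> v ! j"
    using cutD[OF assms(3), of i j] ij len by auto
  then show "w ! i \<le> w ! c \<and> w ! c \<le> w ! j"
    using pseudo_perm_leD(2)[OF assms(2), of i c] pseudo_perm_leD(2)[OF assms(2), of c j] ij len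
    by auto
qed

lemma cut_pack: "cut_at (pack w) c \<longleftrightarrow> cut_at w c"
  using cut_cong pack_le by blast

lemma cut_take: "cut_at u c \<Longrightarrow> cut_at (take k u) c"
  by (auto simp: cut_at_def)

text \<open>For a pair straddling both positions, the cut at \<open>c\<close> places
  \<open>u ! c\<close> in between, and then the cut at \<open>d\<close>, applied to \<open>i\<close>
  and \<open>c\<close>, places \<open>u ! d\<close> between \<open>u ! i\<close> and
  \<open>u ! c\<close>.\<close>

lemma cut_of_take:
  assumes "cut_at u c" and "cut_at (take (Suc c) u) d" and "d < c"
  shows "cut_at u d"
  unfolding cut_at_def
proof (intro allI impI)
  fix i j assume ij: "i < d" "d < j" "j < length u" "u ! i \<le> u ! j"
  have lower: "u ! i \<le> u ! d \<and> u ! d \<le> u ! l" if "d < l" "l \<le> c" "l < length u" "u ! i \<le> u ! l" for l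
    using cutD[OF assms(2), of i l] ij(1) that assms(3) by auto
  show "u ! i \<le> u ! d \<and> u ! d \<le> u ! j"
  proof (cases "j \<le> c")
    case True
    then show ?thesis using lower[of j] ij by auto
  next
    case False
    then have "u ! i \<le> u ! c" "u ! c \<le> u ! j"
      using cutD[OF assms(1), of i j] ij assms(3) by auto
    then show ?thesis
      using lower[of c] assms(3) ij False by auto
  qed
qed

text \<open>A word with a cut is the largest one with its two pieces.\<close>

lemma pseudo_perm_le_cutI:
  assumes len: "length w = length u" and c: "cut_at u c"
    and le: "pseudo_perm_le (take (Suc c) w) (take (Suc c) u)" "pseudo_perm_le (drop c w) (drop c u)"
  shows "pseudo_perm_le w u"
proof -
  have left: "(u ! i \<le> u ! j \<longrightarrow> w ! i \<le> w ! j) \<and> (u ! i < u ! j \<longrightarrow> w ! i < w ! j)"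
    if "i < j" "j \<le> c" "j < length u" for i j
    using le(1) that by (auto simp: pseudo_perm_le_iff)
  have right: "(u ! i \<le> u ! j \<longrightarrow> w ! i \<le> w ! j) \<and> (u ! i < u ! j \<longrightarrow> w ! i < w ! j)"
    if "i < j" "c \<le> i" "j < length u" for i j
    using pseudo_perm_leD(2,3)[OF le(2), of "i - c" "j - c"] that len by auto
  have "(u ! i \<le> u ! j \<longrightarrow> w ! i \<le> w ! j) \<and> (u ! i < u ! j \<longrightarrow> w ! i < w ! j)"
    if ij: "i < j" "j < length u" for i j
  proof (cases "i < c \<and> c < j")
    case True
    \<comment> \<open>The cut gives \<open>u ! i \<le> u ! c \<le> u ! j\<close>, and
      \<open>w\<close> inherits this chain from the two pieces. If \<open>u ! i < u ! j\<close>, one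
      link is strict, also in \<open>w\<close>.\<close>
    then show ?thesis
      using cutD[OF c, of i j] left[of i c] right[of c j] ij by auto
  next
    case False
    then show ?thesis
      using left[of i j] right[of i j] ij by auto
  qed
  then show ?thesis
    using len by (auto simp: pseudo_perm_le_iff)
qed

section \<open>Secability in terms of cuts\<close>

text \<open>Here \<open>c\<close> is \<open>k - 1\<close>. The letters missing from the left piece
  lie below \<open>a\<close> or strictly between \<open>u ! c\<close> and \<open>b\<close>, which
  leaves no room for a non-inverted pair that avoids passing through \<open>u ! c\<close>.
  Conversely, packedness makes every integer inside these intervals a letter, to which the cut
  condition can be applied.\<close>

lemma secable_conditions_iff_cut:
  assumes u: "packed u" and c: "c < length u"
  shows "(\<exists>a b. a \<le> u ! c \<and> set (take (Suc c) u) = {a..u ! c} \<union> {b..Max (set u)}) \<and>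
      set (take (Suc c) u) \<inter> set (drop c u) = {u ! c} \<longleftrightarrow> cut_at u c"
    (is "(\<exists>a b. ?I a b) \<and> ?D \<longleftrightarrow> _")
proof
  let ?P = "set (take (Suc c) u)"
  have P: "u ! i \<in> ?P" if "i \<le> c" for i
    using that c by (auto simp: in_set_conv_nth intro!: exI[of _ i])
  have Q: "u ! j \<in> set (drop c u)" if "c \<le> j" "j < length u" for j
    using that by (auto simp: in_set_conv_nth intro!: exI[of _ "j - c"])
  {
    assume "(\<exists>a b. ?I a b) \<and> ?D"
    then obtain a b where ab: "?I a b" and D: "?D" by blast
    \<comment> \<open>A later letter that also occurs in the left piece can only be the shared
      one.\<close>
    have mid: "u ! j = u ! c" if "u ! j \<in> ?P" "c < j" "j < length u" for j
      using D Q[of j] that by auto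
    show "cut_at u c"
      unfolding cut_at_def
    proof (intro allI impI)
      fix i j assume ij: "i < c" "c < j" "j < length u" "u ! i \<le> u ! j"
      have "u ! i \<in> {a..u ! c} \<union> {b..Max (set u)}"
        using ab P[of i] ij by auto
      moreover have "u ! j \<le> Max (set u)"
        using ij by simp
      \<comment> \<open>If the conclusion fails, \<open>u ! j\<close> falls into the same interval
        as \<open>u ! i\<close>, hence is a letter of the left piece; \<open>mid\<close> then makes
        it equal to \<open>u ! c\<close>, which is absurd.\<close>
      ultimately have "u ! j \<in> {a..u ! c} \<union> {b..Max (set u)}" if "u ! j < u ! c \<or> u ! i > u ! c"
        using that ij by auto
      then show "u ! i \<le> u ! c \<and> u ! c \<le> u ! j"
        using mid[of j] ab ij by (metis leI order.asym order_le_less_trans)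
    qed
  next
    assume cut: "cut_at u c"
    have Pex: "\<exists>i\<le>c. x = u ! i" if "x \<in> ?P" for x
      using that c by (auto simp: in_set_conv_nth less_Suc_eq_le)
    have Qex: "\<exists>j\<ge>c. j < length u \<and> x = u ! j" if "x \<in> set (drop c u)" for x
    proof -
      from that obtain l where "l < length u - c" "x = u ! (c + l)"
        using c by (auto simp: in_set_conv_nth)
      then show ?thesis
        by (intro exI[of _ "c + l"]) auto
    qed
    have D: "x = u ! c" if x: "x \<in> ?P" "x \<in> set (drop c u)" for x
    proof -
      obtain i j where "i \<le> c" "x = u ! i" "c \<le> j" "j < length u" "x = u ! j"
        using Pex[OF x(1)] Qex[OF x(2)] by blast
      then show ?thesis
        using cutD[OF cut, of i j] by (cases "i = c"; cases "j = c") auto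
    qed
    have new: "c < j" if "z \<notin> ?P" "z = u ! j" for z j
      using that P[of j] by (metis leI)
    \<comment> \<open>The lower interval starts at the least letter of the left piece, among those
      up to \<open>u ! c\<close>.\<close>
    define a where "a = Min {y \<in> ?P. y \<le> u ! c}"
    have a: "a \<in> ?P" "a \<le> u ! c" "\<And>y. y \<in> ?P \<Longrightarrow> y \<le> u ! c \<Longrightarrow> a \<le> y"
      using Min_in[of "{y \<in> ?P. y \<le> u ! c}"] P[of c] unfolding a_def by (auto intro: Min_le)
    define U where "U = {y \<in> ?P. u ! c < y}"
    \<comment> \<open>The upper interval starts at the least left letter above \<open>u ! c\<close>;
      if there is none, \<open>Suc (Max (set u))\<close> makes it empty.\<close>
    define b where "b = (if U = {} then Suc (Max (set u)) else Min U)"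
    have b: "b \<in> U \<or> b = Suc (Max (set u))"
      using Min_in[of U] unfolding b_def by (auto simp: U_def)
    have b_le: "b \<le> y" if "y \<in> U" for y
      using that unfolding b_def by (auto simp: U_def intro: Min_le)
    have Ps: "?P \<subseteq> set u"
      by (auto dest: in_set_takeD)
    have "z \<in> {a..u ! c} \<union> {b..Max (set u)}" if "z \<in> ?P" for z
      using that a(3)[of z] b_le[of z] Ps by (cases "z \<le> u ! c") (auto simp: U_def)
    moreover have "z \<in> ?P" if z: "z \<in> {a..u ! c} \<union> {b..Max (set u)}" for z
    proof (rule ccontr)
      \<comment> \<open>A gap \<open>z\<close> in one of the intervals would be a letter of
        \<open>u\<close> occurring only after \<open>c\<close>. Together with an earlier letter at
        most \<open>z\<close> in the same interval it violates the cut condition.\<close>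
      assume nz: "z \<notin> ?P"
      have "u \<noteq> []"
        using c by auto
      then have "Max (set u) \<in> set u" "u ! c \<in> set u" "a \<in> set u" "b \<in> set u \<or> b > Max (set u)"
        using c a(1) b Ps by (auto simp: U_def less_Suc_eq_le)
      then have "z \<in> set u"
        using z set_packed[OF u] by (metis Un_iff atLeastAtMost_iff leD order_trans)
      then obtain j where j: "j < length u" "z = u ! j"
        by (auto simp: in_set_conv_nth)
      have cj: "c < j"
        using new nz j by blast
      show False
      proof (cases "z \<le> u ! c")
        case True
        obtain y where y: "y \<in> ?P" "y \<le> z"
          using z True a(1) b c by (auto simp: U_def)
        then obtain i where i: "i \<le> c" "y = u ! i"
          using Pex by blast
        then have "u ! c \<le> z"
          using cutD[OF cut, of i j] y cj j by (cases "i = c") auto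
        then show False
          using True nz P[of c] by simp
      next
        case False
        then have "b \<le> z" "z \<le> Max (set u)"
          using z by auto
        then have "b \<in> U"
          using b by auto
        then obtain i where i: "i \<le> c" "b = u ! i" "u ! c < b"
          using Pex by (auto simp: U_def)
        then show False
          using cutD[OF cut, of i j] \<open>b \<le> z\<close> cj j by (cases "i = c") auto
      qed
    qed
    ultimately have "?I a b"
      using a(2) by blast
    moreover have ?D
      using D P[OF order_refl] Q[OF order_refl c] by blast
    ultimately show "(\<exists>a b. ?I a b) \<and> ?D"
      by blast
  }
qed

text \<open>With \<open>k = Suc c\<close>, the range of \<open>k\<close> becomes the interior
  positions, the only ones at which being a cut is not automatic.\<close>

lemma nonsecable_iff_cut:
  "nonsecable u \<longleftrightarrow> packed u \<and> 2 \<le> length u \<and> (\<forall>c\<ge>1. Suc c < length u \<longrightarrow> \<not> cut_at u c)"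
proof -
  have "secable u \<longleftrightarrow> (\<exists>c\<ge>1. Suc c < length u \<and> cut_at u c)" if u: "packed u"
  proof -
    have "secable u \<longleftrightarrow> (\<exists>k. 2 \<le> k \<and> k < length u \<and> cut_at u (k - 1))"
    proof -
      have "(\<exists>a b. a \<le> u ! (k - 1) \<and> set (take k u) = {a..u ! (k - 1)} \<union> {b..Max (set u)}) \<and>
          set (take k u) \<inter> set (drop (k - 1) u) = {u ! (k - 1)} \<longleftrightarrow> cut_at u (k - 1)"
        if "2 \<le> k" "k < length u" for k
      proof -
        have "Suc (k - 1) = k" "k - 1 < length u"
          using that by auto
        then show ?thesis
          using secable_conditions_iff_cut[OF u, of "k - 1"] by (simp only:)
      qed
      then show ?thesis
        unfolding secable_def using u by (simp cong: conj_cong)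
    qed
    also have "\<dots> \<longleftrightarrow> (\<exists>c\<ge>1. Suc c < length u \<and> cut_at u c)"
    proof (intro iffI; elim exE conjE)
      fix k assume "2 \<le> k" "k < length u" "cut_at u (k - 1)"
      then show "\<exists>c\<ge>1. Suc c < length u \<and> cut_at u c"
        by (intro exI[of _ "k - 1"]) auto
    next
      fix c assume "1 \<le> c" "Suc c < length u" "cut_at u c"
      then show "\<exists>k. 2 \<le> k \<and> k < length u \<and> cut_at u (k - 1)"
        by (intro exI[of _ "Suc c"]) auto
    qed
    finally show ?thesis .
  qed
  then show ?thesis
    unfolding nonsecable_def by auto
qed

text \<open>Letters of \<open>p\<close> below (above) the common letter are placed above the letters of \<open>q\<close> below
  (above) it.\<close>

definition glue :: "word \<Rightarrow> word \<Rightarrow> word" where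
  "glue p q = pack (map (\<lambda>x. if x \<le> last p then x + hd q else x + hd q + Max (set q)) p
     @ map (\<lambda>y. if y < hd q then y else y + last p) (tl q))"

text \<open>Everything is checked on the unpacked word \<open>g\<close> and transferred through
  \<open>pack\<close>. The increasing maps \<open>f\<close> and \<open>h\<close> agree on the shared
  letter, so the pieces of \<open>g\<close> are relabellings of \<open>p\<close> and
  \<open>q\<close>. The values form four ascending blocks: small letters of \<open>q\<close>,
  letters of \<open>p\<close> up to the shared one, letters of \<open>q\<close> from the shared one
  on, large letters of \<open>p\<close>.\<close>

lemma glue:
  assumes p: "packed p" "p \<noteq> []" and q: "packed q" "q \<noteq> []"
  shows length_glue: "length (glue p q) = length p + length q - 1"
    and packed_glue: "packed (glue p q)"
    and take_glue: "pack (take (length p) (glue p q)) = p"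
    and drop_glue: "pack (drop (length p - 1) (glue p q)) = q"
    and cut_glue: "cut_at (glue p q) (length p - 1)"
proof -
  define f where "f x = (if x \<le> last p then x + hd q else x + hd q + Max (set q))" for x
  define h where "h y = (if y < hd q then y else y + last p)" for y
  define g where "g = map f p @ map h (tl q)"
  have glue: "glue p q = pack g"
    by (simp add: glue_def g_def f_def[abs_def] h_def[abs_def])
  have mono: "strict_mono f" "strict_mono h"
    by (auto simp: strict_mono_def f_def h_def)
  \<comment> \<open>Positivity puts \<open>x + hd q\<close> strictly above the letters of
    \<open>q\<close> that are less than \<open>hd q\<close>.\<close>
  have pos: "1 \<le> x" if "x \<in> set p" for x
    using is_word_packed[OF p(1)] p(2) that by (simp add: is_word_def)
  have mid: "f (last p) = h (hd q)"
    by (simp add: f_def h_def)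
  have "drop (length p - 1) (map f p) = [f (last p)]"
    using p(2) by (cases p rule: rev_cases) auto
  then have drop: "drop (length p - 1) g = map h q"
    using p(2) q(2) mid by (cases q) (auto simp: g_def)
  have take: "take (length p) g = map f p"
    by (simp add: g_def)
  have nth: "g ! (length p - 1) = f (last p)"
    using p(2) by (simp add: g_def nth_append last_conv_nth)
  show "length (glue p q) = length p + length q - 1"
    using q(2) by (simp add: glue g_def Suc_le_eq flip: length_greater_0_conv)
  show "packed (glue p q)"
    by (simp add: glue)
  show "pack (take (length p) (glue p q)) = p"
    using p(1) mono(1) by (simp add: glue pack_take_pack take pack_map strict_mono_on_def
        strict_mono_def packed_def)
  show "pack (drop (length p - 1) (glue p q)) = q"
    using q(1) mono(2) by (simp add: glue pack_drop_pack drop[simplified] pack_map strict_mono_on_def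
        strict_mono_def packed_def)
  have "cut_at g (length p - 1)"
    unfolding cut_at_def nth
  proof (intro allI impI)
    fix i j assume ij: "i < length p - 1" "length p - 1 < j" "j < length g" "g ! i \<le> g ! j"
    have i: "g ! i = f (p ! i)" "p ! i \<in> set p"
      using ij by (auto simp: g_def nth_append)
    have "j - length p < length (tl q)" "\<not> j < length p"
      using ij by (auto simp: g_def)
    then have j: "g ! j = h (tl q ! (j - length p))" "tl q ! (j - length p) \<in> set (tl q)"
      by (auto simp: g_def nth_append simp del: length_tl)
    then have m: "tl q ! (j - length p) \<le> Max (set q)"
      using q(2) by (auto dest: list.set_sel(2))
    show "g ! i \<le> f (last p) \<and> f (last p) \<le> g ! j"
      using ij(4) pos[OF i(2)] m unfolding i(1) j(1) by (auto simp: f_def h_def split: if_splits)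
  qed
  then show "cut_at (glue p q) (length p - 1)"
    by (simp add: glue cut_pack)
qed

text \<open>Maximality of the glued word: it has a cut at the shared position, and its pieces are
  equivalent to \<open>p\<close> and \<open>q\<close>.\<close>

lemma pseudo_perm_le_glueI:
  assumes p: "packed p" "p \<noteq> []" and q: "packed q" "q \<noteq> []"
    and "length w = length p + length q - 1"
    and "pseudo_perm_le (take (length p) w) p" "pseudo_perm_le (drop (length p - 1) w) q"
  shows "pseudo_perm_le w (glue p q)"
proof (rule pseudo_perm_le_cutI)
  show "length w = length (glue p q)"
    using assms length_glue by simp
  show "cut_at (glue p q) (length p - 1)"
    using p q by (rule cut_glue)
  have "pseudo_perm_le p (take (length p) (glue p q))"
    using pack_le(1)[of "take (length p) (glue p q)"] take_glue[OF p q] by simp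
  then show "pseudo_perm_le (take (Suc (length p - 1)) w) (take (Suc (length p - 1)) (glue p q))"
    using assms(6) pseudo_perm_le_trans[of "take (length p) w" p] p(2) by simp
  have "pseudo_perm_le q (drop (length p - 1) (glue p q))"
    using pack_le(1)[of "drop (length p - 1) (glue p q)"] drop_glue[OF p q] by simp
  then show "pseudo_perm_le (drop (length p - 1) w) (drop (length p - 1) (glue p q))"
    using assms(7) pseudo_perm_le_trans by blast
qed

text \<open>Both words have a cut at \<open>c\<close> and equivalent pieces, so each is below the
  other.\<close>

lemma glue_pieces:
  assumes u: "packed u" and c: "c < length u" "cut_at u c"
  shows "glue (pack (take (Suc c) u)) (pack (drop c u)) = u"
proof -
  let ?p = "pack (take (Suc c) u)" and ?q = "pack (drop c u)"
  have p: "packed ?p" "?p \<noteq> []" and q: "packed ?q" "?q \<noteq> []"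
    using c by auto
  have len: "length ?p = Suc c" "length u = length ?p + length ?q - 1"
    using c by auto
  have le: "pseudo_perm_le u (glue ?p ?q)"
    using p q len(2)
  proof (rule pseudo_perm_le_glueI)
    show "pseudo_perm_le (take (length ?p) u) ?p"
      unfolding len(1) by (rule pack_le)
    show "pseudo_perm_le (drop (length ?p - 1) u) ?q"
      unfolding len(1) diff_Suc_1 by (rule pack_le)
  qed
  have "pseudo_perm_le (glue ?p ?q) u"
  proof (rule pseudo_perm_le_cutI)
    show "length (glue ?p ?q) = length u"
      unfolding length_glue[OF p q] by (rule len(2)[symmetric])
    have "pseudo_perm_le (take (Suc c) (glue ?p ?q)) ?p"
      using pack_le(2)[of "take (Suc c) (glue ?p ?q)"]
      unfolding take_glue[OF p q, unfolded len(1)] .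
    then show "pseudo_perm_le (take (Suc c) (glue ?p ?q)) (take (Suc c) u)"
      using pack_le(1) by (rule pseudo_perm_le_trans)
    have "pseudo_perm_le (drop c (glue ?p ?q)) ?q"
      using pack_le(2)[of "drop c (glue ?p ?q)"]
      unfolding drop_glue[OF p q, unfolded len(1) diff_Suc_1] .
    then show "pseudo_perm_le (drop c (glue ?p ?q)) (drop c u)"
      using pack_le(1) by (rule pseudo_perm_le_trans)
  qed (rule c)
  then show ?thesis
    using le u packed_glue[OF p q] by (intro pseudo_perm_le_antisym)
qed


section \<open>Unique factorization into non-secable words\<close>

text \<open>Bracketed like the products in \<open>evaluation\<close>, with \<open>[1]\<close> in the
  place of the unit \<open>M [1]\<close>, so that leading words can be followed by
  induction.\<close>

definition glue_list :: "word list \<Rightarrow> word" where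
  "glue_list us = foldr glue us [1]"

lemma packed_one: "packed [1]"
proof -
  have "{y. y = Suc 0 \<and> y \<le> Suc 0} = {Suc 0}"
    by auto
  then show ?thesis
    by (simp add: packed_def pack_def)
qed

lemma packed_length_one: "packed u \<Longrightarrow> length u = 1 \<Longrightarrow> u = [1]"
  using set_packed[of u] by (auto simp: length_Suc_conv)

lemma nonsecable_imp: "nonsecable u \<Longrightarrow> packed u \<and> u \<noteq> [] \<and> 2 \<le> length u"
  by (auto simp: nonsecable_def)

lemma glue_list_packed:
  assumes "us \<in> lists {u. nonsecable u}"
  shows "packed (glue_list us) \<and> glue_list us \<noteq> []"
  using assms
proof (induction us)
  case Nil
  then show ?case using packed_one by (simp add: glue_list_def)
next
  case (Cons p us)
  then have p: "packed p" "p \<noteq> []" "2 \<le> length p" and IH: "packed (glue_list us)" "glue_list us \<noteq> []"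
    using nonsecable_imp by auto
  have "length (glue p (glue_list us)) \<noteq> 0"
    using length_glue[OF p(1,2) IH] p(3) by simp
  then show ?case
    using packed_glue[OF p(1,2) IH] by (simp add: glue_list_def)
qed

text \<open>The first factor is recovered from the least positive cut.\<close>

lemma glue_nonsecable_inj:
  assumes p: "nonsecable p" "nonsecable p'" and q: "packed q" "q \<noteq> []" "packed q'" "q' \<noteq> []"
    and eq: "glue p q = glue p' q'"
  shows "p = p' \<and> q = q'"
proof -
  \<comment> \<open>If \<open>p\<close> were longer, the cut coming from the end of
    \<open>p'\<close> would be an interior cut of \<open>p\<close>. Exchanging the roles then gives
    equal lengths, and equal pieces.\<close>
  have aux: "length p \<le> length p'"
    if "nonsecable p" "nonsecable p'" "packed q" "q \<noteq> []" "packed q'" "q' \<noteq> []"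
      and eq: "glue p q = glue p' q'" for p p' q q'
  proof (rule ccontr)
    assume less: "\<not> length p \<le> length p'"
    note p = that(1,2)[THEN nonsecable_imp]
    have "cut_at (glue p q) (length p' - 1)"
      using cut_glue[of p' q'] p that by simp
    then have "cut_at (pack (take (length p) (glue p q))) (length p' - 1)"
      by (simp add: cut_pack cut_take)
    then have "cut_at p (length p' - 1)"
      using take_glue[of p q] p that by simp
    then show False
      using that(1) less p unfolding nonsecable_iff_cut by auto
  qed
  have len: "length p = length p'"
    using aux[OF p q eq] aux[OF p(2,1) q(3,4,1,2) eq[symmetric]] by simp
  note pp = p[THEN nonsecable_imp]
  show ?thesis
    using take_glue[of p q] take_glue[of p' q'] drop_glue[of p q] drop_glue[of p' q'] pp q eq len
    by metis
qed

lemma inj_on_glue_list: "inj_on glue_list (lists {u. nonsecable u})"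
proof (rule inj_onI)
  fix us vs assume "us \<in> lists {u. nonsecable u}" "vs \<in> lists {u. nonsecable u}"
    "glue_list us = glue_list vs"
  then show "us = vs"
  proof (induction us arbitrary: vs rule: list.induct)
    \<comment> \<open>Only the empty list can yield the one-letter word \<open>[1]\<close>.\<close>
    have len: "2 \<le> length (glue_list (p # us))" if "p # us \<in> lists {u. nonsecable u}" for p us
    proof -
      have "length (glue p (glue_list us)) = length p + length (glue_list us) - 1"
        using that glue_list_packed[of us] nonsecable_imp[of p] by (intro length_glue) auto
      moreover have "1 \<le> length (glue_list us)"
        using that glue_list_packed[of us] by (cases "glue_list us") auto
      moreover have "2 \<le> length p"
        using that nonsecable_imp[of p] by auto
      ultimately show ?thesis
        by (simp add: glue_list_def)
    qed
    {
      case Nil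
      then show ?case
        using len[of "hd vs" "tl vs"] by (cases vs) (auto simp: glue_list_def)
    next
      case (Cons p us)
      then obtain p' vs' where vs: "vs = p' # vs'"
        using len[of p us] by (cases vs) (auto simp: glue_list_def)
      have us: "nonsecable p" "us \<in> lists {u. nonsecable u}"
          "nonsecable p'" "vs' \<in> lists {u. nonsecable u}"
        using Cons.prems(1,2) vs by auto
      have "p = p' \<and> glue_list us = glue_list vs'"
        using us glue_list_packed Cons.prems(3)
        by (intro glue_nonsecable_inj) (auto simp: glue_list_def vs)
      then show ?case
        using Cons.IH us vs by blast
    }
  qed
qed

text \<open>Strong induction on the length, splitting off the left piece at the least positive
  cut.\<close>

lemma glue_list_surj:
  assumes "packed u" "u \<noteq> []"
  shows "\<exists>us \<in> lists {u. nonsecable u}. glue_list us = u"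
  using assms
proof (induction "length u" arbitrary: u rule: less_induct)
  case less
  show ?case
  proof (cases "length u = 1")
    case True
    then have "u = [1]"
      using less.prems packed_length_one by blast
    then show ?thesis
      by (intro bexI[of _ "[]"]) (auto simp: glue_list_def)
  next
    case False
    have len: "2 \<le> length u"
      using False less.prems(2) by (cases u rule: remdups_adj.cases) auto
    \<comment> \<open>Such a cut exists since the last position is one. If \<open>u\<close> is
      itself non-secable, it is the last position and the right piece packs to
      \<open>[1]\<close>.\<close>
    define c where "c = (LEAST c. 1 \<le> c \<and> cut_at u c)"
    have last: "1 \<le> length u - 1 \<and> cut_at u (length u - 1)"
      using len by (auto simp: cut_at_def)
    have c: "1 \<le> c" "cut_at u c"
      using LeastI[of "\<lambda>c. 1 \<le> c \<and> cut_at u c", OF last] by (simp_all add: c_def)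
    have c_less: "c < length u"
      using Least_le[of "\<lambda>c. 1 \<le> c \<and> cut_at u c", OF last] len
      unfolding c_def[symmetric] by linarith
    let ?p = "pack (take (Suc c) u)" and ?q = "pack (drop c u)"
    \<comment> \<open>An interior cut of the left piece would be a smaller positive cut of
      \<open>u\<close>.\<close>
    have "\<not> cut_at ?p d" if "1 \<le> d" "d < c" for d
    proof
      assume "cut_at ?p d"
      then have "cut_at u d"
        using cut_of_take[OF c(2) _ that(2)] by (simp add: cut_pack)
      then show False
        using not_less_Least[of d "\<lambda>c. 1 \<le> c \<and> cut_at u c"] that
        unfolding c_def[symmetric] by blast
    qed
    then have "nonsecable ?p"
      using c c_less by (auto simp: nonsecable_iff_cut)
    moreover have "length ?q < length u" "?q \<noteq> []"
      using c c_less by auto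
    then obtain us where "us \<in> lists {u. nonsecable u}" "glue_list us = ?q"
      using less.hyps[of ?q] packed_pack by blast
    ultimately show ?thesis
      using glue_pieces[OF less.prems(1) c_less c(2)]
      by (intro bexI[of _ "?p # us"]) (auto simp: glue_list_def)
  qed
qed


section \<open>The algebra of quasi-symmetric word series\<close>

lemma sum_apply: "(\<Sum>i\<in>I. F i) x = (\<Sum>i\<in>I. F i x)" for F :: "'i \<Rightarrow> 'a \<Rightarrow> 'b::comm_monoid_add"
  by (induction I rule: infinite_finite_induct) auto

text \<open>A pair of words with product \<open>w\<close> is determined by the position of the
  shared letter.\<close>

lemma sharp_eq: "sharp f g w = (\<Sum>i<length w. f (take (Suc i) w) * g (drop i w))"
proof -
  have "bij_betw (\<lambda>i. (take (Suc i) w, drop i w)) {..<length w} {(p, q). word_sharp p q = Some w}"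
  proof (rule bij_betw_byWitness[where f' = "\<lambda>(p, q). length p - 1"])
    show "(\<lambda>i. (take (Suc i) w, drop i w)) ` {..<length w} \<subseteq> {(p, q). word_sharp p q = Some w}"
    proof (rule image_subsetI)
      fix i assume "i \<in> {..<length w}"
      then have i: "i < length w" by simp
      then have "take (Suc i) w = take i w @ [w ! i]" "drop i w = w ! i # drop (Suc i) w"
        by (simp_all add: take_Suc_conv_app_nth Cons_nth_drop_Suc)
      moreover have "w = take i w @ w ! i # drop (Suc i) w"
        using i by (rule id_take_nth_drop)
      ultimately show "(take (Suc i) w, drop i w) \<in> {(p, q). word_sharp p q = Some w}"
        by (simp add: word_sharp_def)
    qed
    have "\<exists>x u v. p = u @ [x] \<and> q = x # v \<and> w = u @ x # v" if "word_sharp p q = Some w" for p q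
      using that by (cases p rule: rev_cases; cases q) (auto simp: word_sharp_def split: if_splits)
    then show "\<forall>a\<in>{(p, q). word_sharp p q = Some w}.
        (\<lambda>i. (take (Suc i) w, drop i w)) ((\<lambda>(p, q). length p - 1) a) = a"
      "(\<lambda>(p, q). length p - 1) ` {(p, q). word_sharp p q = Some w} \<subseteq> {..<length w}"
      by fastforce+
  qed auto
  from sum.reindex_bij_betw[OF this, of "\<lambda>(p, q). f p * g q"] show ?thesis
    by (simp add: sharp_def)
qed

text \<open>Both sides sum over two shared positions \<open>i\<close> and \<open>j\<close> with
  \<open>i \<le> j\<close> in \<open>w\<close>; substituting \<open>l = j - i\<close> exchanges the
  order of summation.\<close>

lemma sharp_assoc: "sharp (sharp f g) h = sharp f (sharp g h)"
proof
  fix w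
  let ?t = "\<lambda>i l. f (take (Suc i) w) * (g (take (Suc l) (drop i w)) * h (drop (i + l) w))"
  have "sharp (sharp f g) h w = (\<Sum>j<length w. \<Sum>i\<le>j. ?t i (j - i))"
    unfolding sharp_eq
  proof (intro sum.cong refl)
    fix j assume "j \<in> {..<length w}"
    then have "{..<length (take (Suc j) w)} = {..j}"
      by auto
    then show "(\<Sum>i<length (take (Suc j) w). f (take (Suc i) (take (Suc j) w)) *
        g (drop i (take (Suc j) w))) * h (drop j w) = (\<Sum>i\<le>j. ?t i (j - i))"
      by (simp add: sum_distrib_right drop_take Suc_diff_le min_absorb1 mult.assoc)
  qed
  also have "\<dots> = (\<Sum>(i, l)\<in>{(i, l). i + l < length w}. ?t i l)"
    by (rule sum.triangle_reindex[symmetric])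
  also have "{(i, l). i + l < length w} = (SIGMA i:{..<length w}. {..<length w - i})"
    by auto
  also have "(\<Sum>(i, l)\<in>\<dots>. ?t i l) = (\<Sum>i<length w. \<Sum>l<length w - i. ?t i l)"
    by (rule sum.Sigma[symmetric]) auto
  also have "\<dots> = sharp f (sharp g h) w"
    by (simp add: sharp_eq sum_distrib_left add.commute)
  finally show "sharp (sharp f g) h w = sharp f (sharp g h) w" .
qed

section \<open>Intrinsic description of \<open>WQSym\<close>\<close>

text \<open>The length bound expresses finiteness of the combination, as each length has finitely
  many packed words. The guard \<open>is_word w\<close> matters: a list containing the letter 0 is
  not a word, yet its packing is.\<close>

definition word_quasi_symmetric :: "'k::field series \<Rightarrow> bool" where
  "word_quasi_symmetric f \<longleftrightarrow> (\<forall>w. \<not> is_word w \<longrightarrow> f w = 0) \<and>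
     (\<forall>w. is_word w \<longrightarrow> f (pack w) = f w) \<and> (\<exists>N. \<forall>w. f w \<noteq> 0 \<longrightarrow> length w \<le> N)"

lemma word_quasi_symmetricD:
  assumes "word_quasi_symmetric f"
  shows "\<not> is_word w \<Longrightarrow> f w = 0" "is_word w \<Longrightarrow> f (pack w) = f w"
  using assms by (auto simp: word_quasi_symmetric_def)

lemma word_quasi_symmetric_pack_cong:
  assumes "word_quasi_symmetric f" "is_word v" "is_word w" "pack v = pack w"
  shows "f v = f w"
  using word_quasi_symmetricD(2)[OF assms(1)] assms(2-4) by metis

lemma is_word_pack: "is_word w \<Longrightarrow> is_word (pack w)"
  by (simp add: is_word_packed is_word_def[of w])

lemma finite_packed_length: "finite {u. packed u \<and> length u \<le> N}"
proof (rule finite_subset)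
  have "set u \<subseteq> {..N}" if "packed u" "length u \<le> N" for u
    using card_length[of u] that by (subst set_packed[OF that(1)]) auto
  then show "{u. packed u \<and> length u \<le> N} \<subseteq> {u. set u \<subseteq> {..N} \<and> length u \<le> N}"
    by blast
qed (simp add: finite_lists_length_le)

lemma word_quasi_symmetric_M:
  assumes "packed u"
  shows "word_quasi_symmetric (M u)"
  unfolding word_quasi_symmetric_def
proof (intro conjI)
  show "\<exists>N. \<forall>w. M u w \<noteq> 0 \<longrightarrow> length w \<le> N"
    by (intro exI[of _ "length u"]) (auto simp: M_def)
  show "\<forall>w. is_word w \<longrightarrow> M u (pack w) = M u w"
    using packed_pack by (auto simp: M_def is_word_pack packed_def)
qed (simp add: M_def)

lemma subspace_word_quasi_symmetric:
  "series.subspace {f :: 'k::field series. word_quasi_symmetric f}"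
proof (rule series.subspaceI)
  fix f g :: "'k series"
  assume fg: "f \<in> {f. word_quasi_symmetric f}" "g \<in> {f. word_quasi_symmetric f}"
  then obtain N N' where "\<forall>w. f w \<noteq> 0 \<longrightarrow> length w \<le> N" "\<forall>w. g w \<noteq> 0 \<longrightarrow> length w \<le> N'"
    by (auto simp: word_quasi_symmetric_def)
  then have "\<forall>w. (f + g) w \<noteq> 0 \<longrightarrow> length w \<le> max N N'"
    by (metis add_0 le_max_iff_disj plus_fun_apply)
  then have "\<exists>N. \<forall>w. (f + g) w \<noteq> 0 \<longrightarrow> length w \<le> N"
    by (rule exI)
  then show "f + g \<in> {f. word_quasi_symmetric f}"
    using fg by (simp add: word_quasi_symmetric_def)
next
  fix c and f :: "'k series"
  assume f: "f \<in> {f. word_quasi_symmetric f}"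
  then obtain N where "\<forall>w. f w \<noteq> 0 \<longrightarrow> length w \<le> N"
    by (auto simp: word_quasi_symmetric_def)
  then have "\<exists>N. \<forall>w. series_scale c f w \<noteq> 0 \<longrightarrow> length w \<le> N"
    by (intro exI[of _ N]) (auto simp: series_scale_def)
  then show "series_scale c f \<in> {f. word_quasi_symmetric f}"
    using f by (simp add: word_quasi_symmetric_def series_scale_def)
qed (auto simp: word_quasi_symmetric_def)

text \<open>At \<open>w\<close> only the term with \<open>u = pack w\<close> survives, so the
  coefficient of \<open>M u\<close> is the value \<open>f u\<close>.\<close>

lemma WQSym_expansion:
  assumes f: "word_quasi_symmetric f" and fin: "finite B"
    and supp: "\<And>u. packed u \<Longrightarrow> f u \<noteq> 0 \<Longrightarrow> u \<in> B"
  shows "f = (\<Sum>u\<in>B. series_scale (f u) (M u))"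
proof
  fix w
  have "(\<Sum>u\<in>B. series_scale (f u) (M u)) w =
      (\<Sum>u\<in>B. if pack w = u then if is_word w then f u else 0 else 0)"
    by (auto simp: sum_apply series_scale_def M_def intro!: sum.cong)
  also have "\<dots> = (if pack w \<in> B \<and> is_word w then f (pack w) else 0)"
    using fin by simp
  also have "\<dots> = f w"
    using word_quasi_symmetricD[OF f, of w] supp[of "pack w"] by (cases "is_word w") auto
  finally show "f w = (\<Sum>u\<in>B. series_scale (f u) (M u)) w" ..
qed

lemma WQSym_eq: "WQSym = {f. word_quasi_symmetric f}"
proof
  show "WQSym \<subseteq> {f. word_quasi_symmetric f}"
    unfolding WQSym_def
    by (rule series.span_minimal) (auto simp: word_quasi_symmetric_M subspace_word_quasi_symmetric)
  show "{f. word_quasi_symmetric f} \<subseteq> WQSym"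
  proof
    fix f assume "f \<in> {f. word_quasi_symmetric f}"
    then have f: "word_quasi_symmetric f" by simp
    then obtain N where N: "\<And>w. f w \<noteq> 0 \<Longrightarrow> length w \<le> N"
      by (auto simp: word_quasi_symmetric_def)
    \<comment> \<open>The empty list is packed but indexes no spanning element of
      \<open>WQSym\<close>.\<close>
    let ?B = "{u. packed u \<and> length u \<le> N} - {[]}"
    have "f [] = 0"
      using word_quasi_symmetricD(1)[OF f] by (simp add: is_word_def)
    then have "f = (\<Sum>u\<in>?B. series_scale (f u) (M u))"
      using f N by (intro WQSym_expansion) (auto simp: finite_packed_length intro!: finite_Diff)
    also have "\<dots> \<in> WQSym"
      unfolding WQSym_def
      by (intro series.span_sum series.span_scale series.span_base) (auto simp: Suc_le_eq)
    finally show "f \<in> WQSym" .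
  qed
qed

text \<open>Corresponding pieces of \<open>w\<close> and \<open>pack w\<close> have the same
  packing, so the sums in \<open>sharp_eq\<close> agree term by term.\<close>

lemma word_quasi_symmetric_sharp:
  assumes f: "word_quasi_symmetric f" and g: "word_quasi_symmetric g"
  shows "word_quasi_symmetric (sharp f g)"
  unfolding word_quasi_symmetric_def
proof (intro conjI allI impI)
  fix w assume "\<not> is_word w"
  have "f (take (Suc i) w) = 0 \<or> g (drop i w) = 0" if "i < length w" for i
  proof (rule ccontr)
    assume "\<not> ?thesis"
    then have "is_word (take (Suc i) w)" "is_word (drop i w)"
      using word_quasi_symmetricD(1)[OF f] word_quasi_symmetricD(1)[OF g] by blast+
    moreover have "set w = set (take i w) \<union> set (drop i w)"
      by (metis append_take_drop_id set_append)
    ultimately have "is_word w"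
      using set_take_subset_set_take[of i "Suc i" w] unfolding is_word_def by auto
    then show False
      using \<open>\<not> is_word w\<close> by simp
  qed
  then show "sharp f g w = 0"
    unfolding sharp_eq by (intro sum.neutral) auto
next
  fix w assume w: "is_word w"
  have "f (take (Suc i) (pack w)) = f (take (Suc i) w)" for i
    using w by (intro word_quasi_symmetric_pack_cong[OF f])
      (auto simp: pack_take_pack is_word_take is_word_pack)
  moreover have "g (drop i (pack w)) = g (drop i w)" if "i < length w" for i
    using w that by (intro word_quasi_symmetric_pack_cong[OF g])
      (auto simp: pack_drop_pack is_word_drop is_word_pack)
  ultimately show "sharp f g (pack w) = sharp f g w"
    by (simp add: sharp_eq)
next
  obtain N N' where N: "\<And>w. f w \<noteq> 0 \<Longrightarrow> length w \<le> N" "\<And>w. g w \<noteq> 0 \<Longrightarrow> length w \<le> N'"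
    using f g by (auto simp: word_quasi_symmetric_def)
  have "length w \<le> N + N'" if nz: "sharp f g w \<noteq> 0" for w
  proof -
    obtain i where "i < length w" "f (take (Suc i) w) \<noteq> 0" "g (drop i w) \<noteq> 0"
      using sum.not_neutral_contains_not_neutral[OF nz[unfolded sharp_eq]] by auto
    then show ?thesis
      using N(1)[of "take (Suc i) w"] N(2)[of "drop i w"] by auto
  qed
  then show "\<exists>N. \<forall>w. sharp f g w \<noteq> 0 \<longrightarrow> length w \<le> N"
    by blast
qed

text \<open>Hence in a product with \<open>M [1]\<close> one shared position survives: the first for
  a left factor, the last for a right factor.\<close>

lemma M_one: "M [1] w = (if is_word w \<and> length w = 1 then 1 else 0)"
proof -
  have "pack w = [1] \<longleftrightarrow> length w = 1"
    using packed_length_one[of "pack w"] length_pack[of w] by (auto simp del: length_pack)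
  then show ?thesis
    by (simp add: M_def)
qed

lemma sharp_one_left:
  assumes "word_quasi_symmetric f"
  shows "sharp (M [1]) f = f"
proof
  fix w
  show "sharp (M [1]) f w = f w"
  proof (cases "is_word w")
    case True
    have "sharp (M [1]) f w = (\<Sum>i<length w. if i = 0 then f w else 0)"
      unfolding sharp_eq using True is_word_take by (intro sum.cong) (auto simp: M_one[simplified])
    then show ?thesis
      using True by (auto simp: is_word_def)
  next
    case False
    then show ?thesis
      using word_quasi_symmetric_sharp[OF word_quasi_symmetric_M[OF packed_one] assms] assms
      by (simp add: word_quasi_symmetric_def)
  qed
qed

lemma sharp_one_right:
  assumes "word_quasi_symmetric f"
  shows "sharp f (M [1]) = f"
proof
  fix w
  show "sharp f (M [1]) w = f w"
  proof (cases "is_word w")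
    case True
    have "sharp f (M [1]) w = (\<Sum>i<length w. if i = length w - 1 then f w else 0)"
      unfolding sharp_eq using True is_word_drop[of w]
      by (intro sum.cong) (auto simp: M_one[simplified])
    then show ?thesis
      using True by (auto simp: is_word_def)
  next
    case False
    then show ?thesis
      using word_quasi_symmetric_sharp[OF assms word_quasi_symmetric_M[OF packed_one]] assms
      by (simp add: word_quasi_symmetric_def)
  qed
qed

lemma unital_algebra_WQSym:
  "unital_algebra series_scale sharp (M [1]) (WQSym :: 'k::field series set)"
proof unfold_locales
  show "series.subspace (WQSym :: 'k series set)"
    unfolding WQSym_eq by (rule subspace_word_quasi_symmetric)
  show "M [1] \<in> (WQSym :: 'k series set)"
    using word_quasi_symmetric_M[OF packed_one] by (simp add: WQSym_eq)
qed (auto simp: WQSym_eq word_quasi_symmetric_sharp sharp_assoc sharp_one_left[simplified]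
    sharp_one_right[simplified] fun_eq_iff sharp_eq series_scale_def algebra_simps sum.distrib
    sum_distrib_left)


section \<open>Unitriangular families\<close>

text \<open>A leading term with coefficient 1. Since comparable words have equal length,
  \<open>f\<close> is also homogeneous of degree \<open>length u\<close>.\<close>

definition dominated :: "'k::field series \<Rightarrow> word \<Rightarrow> bool" where
  "dominated f u \<longleftrightarrow> word_quasi_symmetric f \<and> f u = 1 \<and> (\<forall>w. f w \<noteq> 0 \<longrightarrow> pseudo_perm_le w u)"

lemma dominated_unique:
  assumes "dominated f u" "dominated f v" "packed u" "packed v"
  shows "u = v"
  using assms by (intro pseudo_perm_le_antisym) (auto simp: dominated_def)

lemma dominated_M:
  assumes "packed u" "u \<noteq> []"
  shows "dominated (M u) u"
  using assms word_quasi_symmetric_M[OF assms(1)] pack_le(2) is_word_packed[OF assms(1)]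
  by (auto simp: dominated_def M_def packed_def)

lemma dominated_S:
  assumes "packed u" "u \<noteq> []"
  shows "dominated (S u :: 'k::field series) u"
  unfolding dominated_def
proof (intro conjI)
  \<comment> \<open>The order does not distinguish \<open>w\<close> from \<open>pack w\<close>, so
    \<open>S u\<close> is the indicator of all words below \<open>u\<close>.\<close>
  have S: "S u w = (if is_word w \<and> pseudo_perm_le w u then 1 else 0 :: 'k)" for w
  proof -
    have "S u w = (\<Sum>v | packed v \<and> pseudo_perm_le v u.
        if pack w = v then if is_word w then 1 else 0 else 0 :: 'k)"
      by (auto simp: S_def sum_apply M_def intro!: sum.cong)
    also have "\<dots> = (if pseudo_perm_le (pack w) u \<and> is_word w then 1 else 0)"
      using finite_packed_le[of u] by simp
    also have "pseudo_perm_le (pack w) u \<longleftrightarrow> pseudo_perm_le w u"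
      using pack_le pseudo_perm_le_trans by blast
    finally show ?thesis by auto
  qed
  show "word_quasi_symmetric (S u :: 'k series)"
    unfolding S_def using subspace_word_quasi_symmetric word_quasi_symmetric_M
    by (auto intro!: series.subspace_sum[of "{f. word_quasi_symmetric f}", simplified])
  show "S u u = (1 :: 'k)" "\<forall>w. S u w \<noteq> (0 :: 'k) \<longrightarrow> pseudo_perm_le w u"
    using S assms is_word_packed pseudo_perm_le_refl by auto
qed

text \<open>By homogeneity of both factors only the shared position \<open>length p - 1\<close>
  contributes. At \<open>glue p q\<close> it gives \<open>f p * g q = 1\<close>, and maximality of
  \<open>glue p q\<close> bounds the support.\<close>

lemma dominated_sharp:
  assumes f: "dominated f p" and g: "dominated g q"
    and p: "packed p" "p \<noteq> []" and q: "packed q" "q \<noteq> []"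
  shows "dominated (sharp f g) (glue p q)"
  unfolding dominated_def
proof (intro conjI allI impI)
  have wf: "word_quasi_symmetric f" "word_quasi_symmetric g"
    using f g by (auto simp: dominated_def)
  show "word_quasi_symmetric (sharp f g)"
    using wf by (rule word_quasi_symmetric_sharp)
  have len_f: "length w = length p" if "f w \<noteq> 0" for w
    using f that pseudo_perm_leD(1) unfolding dominated_def by blast
  have len_g: "length w = length q" if "g w \<noteq> 0" for w
    using g that pseudo_perm_leD(1) unfolding dominated_def by blast
  let ?u = "glue p q" and ?c = "length p - 1"
  have Suc_c: "Suc ?c = length p"
    using p by simp
  have len_u: "length ?u = length p + length q - 1"
    using p q by (rule length_glue)
  have c_less: "?c < length ?u"
    using len_u p q by (cases p; cases q) auto
  then have "?u \<noteq> []"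
    by auto
  then have word_u: "is_word ?u"
    using is_word_packed[OF packed_glue[OF p q]] by simp
  have "sharp f g ?u = (\<Sum>i<length ?u. if i = ?c then f (take (length p) ?u) * g (drop ?c ?u) else 0)"
    unfolding sharp_eq
  proof (rule sum.cong[OF refl])
    fix i assume "i \<in> {..<length ?u}"
    then show "f (take (Suc i) ?u) * g (drop i ?u) =
        (if i = ?c then f (take (length p) ?u) * g (drop ?c ?u) else 0)"
      using len_f[of "take (Suc i) ?u"] Suc_c by (cases "i = ?c") fastforce+
  qed
  also have "\<dots> = f (take (length p) ?u) * g (drop ?c ?u)"
    using c_less by simp
  also have "f (take (length p) ?u) = f p"
    using take_glue[OF p q] p is_word_take[OF word_u, of ?c] Suc_c
    by (intro word_quasi_symmetric_pack_cong[OF wf(1)]) (auto simp: is_word_packed packed_def)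
  also have "g (drop ?c ?u) = g q"
    using drop_glue[OF p q] q is_word_drop[OF word_u c_less]
    by (intro word_quasi_symmetric_pack_cong[OF wf(2)]) (auto simp: is_word_packed packed_def)
  finally show "sharp f g ?u = 1"
    using f g by (simp add: dominated_def)
  fix w assume nz: "sharp f g w \<noteq> 0"
  obtain i where i: "i < length w" "f (take (Suc i) w) \<noteq> 0" "g (drop i w) \<noteq> 0"
    using sum.not_neutral_contains_not_neutral[OF nz[unfolded sharp_eq]] by auto
  then have "Suc i = length p" "length w - i = length q"
    using len_f[of "take (Suc i) w"] len_g[of "drop i w"] by auto
  then have "i = ?c" "length w = length p + length q - 1"
    using i(1) by auto
  then show "pseudo_perm_le w ?u"
    using i f g Suc_c p q by (intro pseudo_perm_le_glueI) (auto simp: dominated_def)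
qed

lemma dominated_foldr_sharp:
  assumes "us \<in> lists {u. nonsecable u}" and T: "\<And>u. packed u \<Longrightarrow> u \<noteq> [] \<Longrightarrow> dominated (T u) u"
  shows "dominated (foldr sharp (map T us) (M [1])) (glue_list us)"
  using assms(1)
proof (induction us)
  case Nil
  then show ?case
    using dominated_M[OF packed_one] by (simp add: glue_list_def)
next
  case (Cons u us)
  then show ?case
    using dominated_sharp[of "T u" u _ "glue_list us"] T nonsecable_imp[of u] glue_list_packed[of us]
    by (auto simp: glue_list_def)
qed

text \<open>A strictly monotone height on packed words, providing both maximal leading words and an
  induction measure.\<close>

definition rank :: "word \<Rightarrow> nat" where
  "rank u = card {v. packed v \<and> pseudo_perm_le v u}"

lemma rank_less:
  assumes "packed u" "packed v" "pseudo_perm_le v u" "v \<noteq> u"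
  shows "rank v < rank u"
  unfolding rank_def
proof (rule psubset_card_mono[OF finite_packed_le])
  have "\<not> pseudo_perm_le u v"
    using assms pseudo_perm_le_antisym by blast
  then show "{w. packed w \<and> pseudo_perm_le w v} \<subset> {w. packed w \<and> pseudo_perm_le w u}"
    using assms pseudo_perm_le_refl pseudo_perm_le_trans by blast
qed

section \<open>Evaluation on the free algebra\<close>

lemma evaluation_superset:
  assumes "finite K" "Poly_Mapping.keys p \<subseteq> K"
  shows "evaluation series_scale mult e p =
    (\<Sum>w\<in>K. series_scale (Poly_Mapping.lookup p w) (foldr mult w e))"
  unfolding evaluation_def using assms
  by (intro sum.mono_neutral_left) (auto simp: in_keys_iff series_scale_def fun_eq_iff)

text \<open>Reduces surjectivity onto \<open>WQSym\<close> to hitting each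
  \<open>M u\<close>.\<close>

lemma subspace_evaluation_image:
  "series.subspace (evaluation series_scale mult e ` free_algebra G)"
proof (rule series.subspaceI)
  show "0 \<in> evaluation series_scale mult e ` free_algebra G"
    by (rule image_eqI[of _ _ 0]) (auto simp: evaluation_def free_algebra_def)
next
  fix x y
  assume "x \<in> evaluation series_scale mult e ` free_algebra G"
    "y \<in> evaluation series_scale mult e ` free_algebra G"
  then obtain p q where p: "p \<in> free_algebra G" "x = evaluation series_scale mult e p"
    and q: "q \<in> free_algebra G" "y = evaluation series_scale mult e q" by blast
  let ?K = "Poly_Mapping.keys p \<union> Poly_Mapping.keys q"
  have K: "Poly_Mapping.keys (p + q) \<subseteq> ?K"
    by (rule Poly_Mapping.keys_add)
  have "x + y = evaluation series_scale mult e (p + q)"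
    using K unfolding p q
    by (simp add: evaluation_superset[of ?K] lookup_add series.scale_left_distrib sum.distrib)
  moreover have "p + q \<in> free_algebra G"
    using K p q by (auto simp: free_algebra_def)
  ultimately show "x + y \<in> evaluation series_scale mult e ` free_algebra G"
    by blast
next
  fix c x assume "x \<in> evaluation series_scale mult e ` free_algebra G"
  then obtain p where p: "p \<in> free_algebra G" "x = evaluation series_scale mult e p" by blast
  \<comment> \<open>Scaling by 0 loses keys, so \<open>?q\<close> is evaluated over the keys of
    \<open>p\<close>.\<close>
  let ?q = "Poly_Mapping.map (\<lambda>a. c * a) p"
  have q: "Poly_Mapping.keys ?q \<subseteq> Poly_Mapping.keys p"
    by (auto simp: in_keys_iff map.rep_eq when_def split: if_splits)
  have "Poly_Mapping.lookup ?q w = c * Poly_Mapping.lookup p w" for w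
    by (simp add: map.rep_eq when_def)
  then have "series_scale c x = evaluation series_scale mult e ?q"
    unfolding p evaluation_superset[OF finite_keys q]
    by (simp add: evaluation_def series.scale_sum_right)
  moreover have "?q \<in> free_algebra G"
    using q p by (auto simp: free_algebra_def)
  ultimately show "series_scale c x \<in> evaluation series_scale mult e ` free_algebra G"
    by blast
qed

lemma dominated_family_free:
  fixes T :: "word \<Rightarrow> 'k::field series"
  assumes T: "\<And>u. packed u \<Longrightarrow> u \<noteq> [] \<Longrightarrow> dominated (T u) u"
  shows "freely_generated_algebra series_scale sharp (M [1]) WQSym {T u | u. nonsecable u}"
proof -
  let ?G = "{T u | u. nonsecable u}" and ?N = "{u. nonsecable u}"
  let ?ev = "evaluation series_scale sharp (M [1] :: 'k series)"
  define P where "P w = foldr sharp w (M [1] :: 'k series)" for w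
  have T_nonsec: "dominated (T u) u" if "nonsecable u" for u
    using T nonsecable_imp that by blast
  have lists_G: "lists ?G = map T ` lists ?N"
    unfolding lists_image[symmetric] by (rule arg_cong[of _ _ lists]) auto
  \<comment> \<open>Words of the free algebra are lists of series \<open>T u\<close>;
    \<open>C\<close> chooses for each of them the leading packed word of its product.\<close>
  have "\<exists>C. \<forall>w\<in>lists ?G. packed (C w) \<and> dominated (P w) (C w) \<and>
      (\<exists>us\<in>lists ?N. w = map T us \<and> glue_list us = C w)"
    using dominated_foldr_sharp[OF _ T] glue_list_packed
    unfolding lists_G P_def by (intro bchoice) fast
  then obtain C where C: "\<And>w. w \<in> lists ?G \<Longrightarrow> packed (C w)" "\<And>w. w \<in> lists ?G \<Longrightarrow> dominated (P w) (C w)"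
    "\<And>w. w \<in> lists ?G \<Longrightarrow> \<exists>us\<in>lists ?N. w = map T us \<and> glue_list us = C w" by blast
  have C_inj: "w = w'" if "w \<in> lists ?G" "w' \<in> lists ?G" "C w = C w'" for w w'
    using C(3)[OF that(1)] C(3)[OF that(2)] that(3) inj_on_glue_list by (metis inj_onD)
  have C_surj: "\<exists>w\<in>lists ?G. C w = u" if u: "packed u" "u \<noteq> []" for u
  proof -
    obtain us where us: "us \<in> lists ?N" "glue_list us = u"
      using glue_list_surj[OF u] by blast
    then have w: "map T us \<in> lists ?G"
      by (auto simp: lists_G)
    \<comment> \<open>As \<open>C\<close> is merely chosen, uniqueness of leading words is what
      identifies its value here.\<close>
    have "dominated (P (map T us)) u"
      using dominated_foldr_sharp[OF us(1) T] us(2) by (simp add: P_def)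
    then have "C (map T us) = u"
      using dominated_unique C[OF w] u by blast
    then show ?thesis
      using w by blast
  qed
  have P_WQSym: "P w \<in> WQSym" if "w \<in> lists ?G" for w
    using C(2)[OF that] by (simp add: dominated_def WQSym_eq)
  have WQSym_subspace: "series.subspace (WQSym :: 'k series set)"
    unfolding WQSym_eq by (rule subspace_word_quasi_symmetric)
  have "inj_on ?ev (free_algebra ?G)"
  proof (rule inj_onI, rule ccontr)
    fix p q assume p: "p \<in> free_algebra ?G" and q: "q \<in> free_algebra ?G"
      and eq: "?ev p = ?ev q" and "p \<noteq> q"
    define K where "K = Poly_Mapping.keys p \<union> Poly_Mapping.keys q"
    \<comment> \<open>The coefficients of the linear relation among the products \<open>P w\<close>
      that \<open>p\<close> and \<open>q\<close> would produce.\<close>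
    define d where "d w = Poly_Mapping.lookup p w - Poly_Mapping.lookup q w" for w
    have K: "finite K" "K \<subseteq> lists ?G"
      using p q by (auto simp: K_def free_algebra_def)
    have diff: "(\<Sum>w\<in>K. d w * P w v) = ?ev p v - ?ev q v" for v
      by (simp add: evaluation_superset[of K] K_def sum_apply series_scale_def d_def P_def
          sum_subtractf left_diff_distrib)
    have zero: "(\<Sum>w\<in>K. d w * P w v) = 0" for v
      unfolding diff eq by simp
    define D where "D = {w \<in> K. d w \<noteq> 0}"
    have "D \<noteq> {}"
    proof
      assume "D = {}"
      then have "Poly_Mapping.lookup p w = Poly_Mapping.lookup q w" for w
        by (cases "w \<in> K") (auto simp: D_def d_def K_def in_keys_iff)
      then show False
        using \<open>p \<noteq> q\<close> by (metis poly_mapping_eqI)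
    qed
    moreover have "finite D"
      using K by (simp add: D_def)
    \<comment> \<open>Among the terms of the relation, \<open>m\<close> is one whose leading word
      has maximal rank.\<close>
    ultimately have "Max ((\<lambda>w. rank (C w)) ` D) \<in> (\<lambda>w. rank (C w)) ` D"
      by (intro Max_in) auto
    then obtain m where m: "m \<in> D" "Max ((\<lambda>w. rank (C w)) ` D) = rank (C m)"
      by (rule imageE)
    have m_max: "rank (C w) \<le> rank (C m)" if "w \<in> D" for w
      using \<open>finite D\<close> that unfolding m(2)[symmetric] by (intro Max_ge) auto
    have mG: "m \<in> lists ?G"
      using m K by (auto simp: D_def)
    \<comment> \<open>Another term that does not vanish at \<open>C m\<close> would have a leading
      word strictly above \<open>C m\<close>, of larger rank. So only the term of \<open>m\<close>
      survives there.\<close>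
    have others: "d w * P w (C m) = 0" if w: "w \<in> K - {m}" for w
    proof (rule ccontr)
      assume nz: "d w * P w (C m) \<noteq> 0"
      then have wD: "w \<in> D" and wG: "w \<in> lists ?G"
        using w K by (auto simp: D_def)
      have "pseudo_perm_le (C m) (C w)"
        using nz C(2)[OF wG] by (auto simp: dominated_def)
      moreover have "C m \<noteq> C w"
        using C_inj[OF mG wG] w by auto
      ultimately show False
        using rank_less[OF C(1)[OF wG] C(1)[OF mG]] m_max[OF wD] by auto
    qed
    have "(\<Sum>w\<in>K. d w * P w (C m)) = d m * P m (C m) + (\<Sum>w\<in>K - {m}. d w * P w (C m))"
      using K(1) m(1) by (intro sum.remove) (auto simp: D_def)
    also have "(\<Sum>w\<in>K - {m}. d w * P w (C m)) = 0"
      using others by (intro sum.neutral ballI)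
    also have "d m * P m (C m) + 0 = d m * P m (C m)"
      by simp
    also have "\<dots> \<noteq> 0"
      using m(1) C(2)[OF mG] by (simp add: D_def dominated_def)
    finally show False
      using zero by simp
  qed
  moreover have "?ev ` free_algebra ?G \<subseteq> WQSym"
  proof (rule image_subsetI)
    fix p :: "'k series list \<Rightarrow>\<^sub>0 'k"
    assume "p \<in> free_algebra ?G"
    then have "w \<in> lists ?G" if "w \<in> Poly_Mapping.keys p" for w
      using that unfolding free_algebra_def by blast
    then show "?ev p \<in> WQSym"
      unfolding evaluation_def P_def[symmetric]
      by (intro series.subspace_sum[OF WQSym_subspace] series.subspace_scale[OF WQSym_subspace]
          P_WQSym)
  qed
  moreover have "WQSym \<subseteq> ?ev ` free_algebra ?G"
  proof -
    have P_in: "P w \<in> ?ev ` free_algebra ?G" if "w \<in> lists ?G" for w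
      using that by (intro image_eqI[of _ _ "Poly_Mapping.single w 1"])
        (auto simp: evaluation_def free_algebra_def P_def series_scale_def)
    have "M u \<in> ?ev ` free_algebra ?G" if "packed u" "u \<noteq> []" for u
      using that
    proof (induction "rank u" arbitrary: u rule: less_induct)
      case less
      obtain w where w: "w \<in> lists ?G" "C w = u"
        using C_surj less.prems by blast
      have dom: "dominated (P w) u"
        using C(2)[OF w(1)] w(2) by simp
      let ?B = "{v. packed v \<and> pseudo_perm_le v u}"
      \<comment> \<open>Unitriangularity: \<open>M u\<close> occurs with coefficient 1 and all other
        terms have smaller rank, so the identity can be solved for \<open>M u\<close>.\<close>
      have "P w = (\<Sum>v\<in>?B. series_scale (P w v) (M v))"
        using dom finite_packed_le by (intro WQSym_expansion) (auto simp: dominated_def)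
      also have "\<dots> = M u + (\<Sum>v\<in>?B - {u}. series_scale (P w v) (M v))"
        using dom less.prems finite_packed_le[of u] pseudo_perm_le_refl
        by (subst sum.remove[of _ u]) (auto simp: dominated_def)
      finally have "M u = P w - (\<Sum>v\<in>?B - {u}. series_scale (P w v) (M v))"
        by (simp add: algebra_simps)
      moreover have "M v \<in> ?ev ` free_algebra ?G" if "v \<in> ?B - {u}" for v
      proof (rule less.hyps)
        show "rank v < rank u"
          using that less.prems rank_less by blast
        show "v \<noteq> []"
          using that less.prems pseudo_perm_leD(1)[of v u] by auto
      qed (use that in simp)
      ultimately show ?case
        using P_in[OF w(1)]
        by (metis (no_types, lifting) series.subspace_diff series.subspace_scale series.subspace_sum
            subspace_evaluation_image)
    qed
    then show ?thesis
      unfolding WQSym_def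
      by (intro series.span_minimal subspace_evaluation_image) (auto simp: Suc_le_eq)
  qed
  ultimately have bij: "bij_betw ?ev (free_algebra ?G) WQSym"
    by (auto simp: bij_betw_def)
  have "?G \<subseteq> WQSym"
    using T_nonsec by (auto simp: dominated_def WQSym_eq)
  with bij show ?thesis
    by (intro freely_generated_algebra.intro unital_algebra_WQSym
        freely_generated_algebra_axioms.intro)
qed

theorem theorem5p5:
  shows "freely_generated_algebra series_scale sharp (M [1]) (WQSym :: 'k::field series set)
           {S u | u. nonsecable u} \<and>
         freely_generated_algebra series_scale sharp (M [1]) (WQSym :: 'k series set)
           {M u | u. nonsecable u}"
  by (intro conjI dominated_family_free dominated_S dominated_M)

end
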